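(* Let $\phi,\psi:A\to L\{\tau\}$ be two rank $r$ Drinfeld $A$-modules over the finite $A$-field $L$. Then $\phi$ and $\psi$ are isomorphic over $L$ if and only if $J_{k_1\cdots k_l}^{\delta_1\cdots\delta_l}(\phi)=J_{k_1\cdots k_l}^{\delta_1\cdots\delta_l}(\psi)$ for all basic $J$-invariants (i.e. all admissible $(k_1,\dots,k_l)$ and $(\delta_1,\dots,\delta_l)$) and $FI(\phi)=FI(\psi)$. In other words, the $L$-isomorphism classes of Drinfeld modules defined over the finite $A$-field $L$ are determined by their fine isomorphy invariants and $J$-invariants.
   Context: $A=\mathbb{F}_q[T]$; $L$ is a finite $A$-field, i.e. a finite field with an $\mathbb{F}_q$-algebra homomorphism $\gamma:A\to L$. $L\{\tau\}$ is the ring of $\mathbb{F}_q$-linear polynomials over $L$ under composition, where $\tau(x)=x^q$ (so $\tau a=a^q\tau$ for $a\in L$). A Drinfeld $A$-module of rank $r$ over $L$ is an $\mathbb{F}_q$-algebra homomorphism $\phi:A\to L\{\tau\}$, determined by $\phi_T=\gamma(T)+g_1\tau+\cdots+g_r\tau^r$ with $g_i\in L$, $g_r\ne0$. For a field $K\supseteq L$, $\phi$ and $\psi$ are isomorphic over $K$ if there is $x\in K^*$ with $\psi_T=x^{-1}\phi_Tx$. Basic $J$-invariants: let $1\le k_1<\cdots<k_l\le r-1$ and let $\delta_1,\dots,\delta_l,\delta_r$ be integers such that (a) $\delta_1(q^{k_1}-1)+\cdots+\delta_l(q^{k_l}-1)=\delta_r(q^r-1)$; (b) $0\le\delta_i\le\frac{q^r-1}{q^{\gcd(k_i,r)}-1}$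 for $i=1,\dots,l$; (c) $\gcd(\delta_1,\dots,\delta_l,\delta_r)=1$. Then $J_{k_1\cdots k_l}^{\delta_1\cdots\delta_l}(\phi)=\dfrac{g_{k_1}^{\delta_1}\cdots g_{k_l}^{\delta_l}}{g_r^{\delta_r}}$. Fine isomorphy invariant: put $I=\{i\in\{1,\dots,r\}: g_i\neq0\}$, $d=\gcd(q^k-1: k\in I)$ $(=q^{\delta}-1$ with $\delta=\gcd(k:k\in I))$, and $B=\{\lambda=(\lambda_k)_{k\in I}\in\mathbb{Z}^I: d=\sum_{k\in I}\lambda_k(q^k-1)\}$. For $\lambda\in B$ let $FI_\lambda(\phi)$ be the class of $\prod_{k\in I}g_k^{\lambda_k}$ in $L^*/L^{*d}$, where $L^{*d}$ is the group of $d$-th powers in $L^*$. Then $FI(\phi)=(FI_\lambda(\phi))_{\lambda\in B}$. The equality $FI(\phi)=FI(\psi)$ is equality of families (with the same index set). *)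

theory Defs
  imports "HOL-Computational_Algebra.Polynomial" "HOL-Library.FuncSet"
    "HOL-Library.Cardinality"
begin

text \<open>
  \<^typ>\<open>'k\<close> is the field with \<open>q = CARD('k)\<close> elements, \<^typ>\<open>'k poly\<close> is \<open>A\<close> with
  \<open>T = [:0, 1:]\<close>, and \<^typ>\<open>'l\<close> is the finite field \<open>L\<close>. The map \<open>\<iota>\<close> is the structure map
  of \<open>L\<close> as an algebra over the field with \<open>q\<close> elements.
\<close>

definition unital_ring_hom :: "('a::comm_ring_1 \<Rightarrow> 'b::comm_ring_1) \<Rightarrow> bool" where
  "unital_ring_hom f \<longleftrightarrow>
     f 1 = 1 \<and> (\<forall>x y. f (x + y) = f x + f y) \<and> (\<forall>x y. f (x * y) = f x * f y)"

definition finite_A_field ::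
  "('k::{field,finite} \<Rightarrow> 'l::{field,finite}) \<Rightarrow> ('k poly \<Rightarrow> 'l) \<Rightarrow> bool" where
  "finite_A_field \<iota> \<gamma> \<longleftrightarrow>
     unital_ring_hom \<iota> \<and> unital_ring_hom \<gamma> \<and> (\<forall>c a. \<gamma> (smult c a) = \<iota> c * \<gamma> a)"

text \<open>
  The underlying set of \<open>L{\<tau>}\<close>, with \<open>\<tau>\<^sup>i = monom 1 (q ^ i)\<close>. The ring operations are
  addition and composition \<^const>\<open>pcompose\<close>; the unit is \<open>[:0, 1:]\<close>, and \<open>x \<in> L\<close> is
  identified with \<open>x \<tau>\<^sup>0 = [:0, x:]\<close>.
\<close>

definition linear_polys :: "nat \<Rightarrow> 'l::comm_ring_1 poly set" where
  "linear_polys q = {f. \<exists>n a. f = (\<Sum>i\<le>n. monom (a i) (q ^ i))}"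

definition drinfeld_module ::
  "('k::{field,finite} \<Rightarrow> 'l::{field,finite}) \<Rightarrow> ('k poly \<Rightarrow> 'l) \<Rightarrow> nat \<Rightarrow>
   ('k poly \<Rightarrow> 'l poly) \<Rightarrow> bool" where
  "drinfeld_module \<iota> \<gamma> r \<phi> \<longleftrightarrow>
     r \<ge> 1 \<and>
     (\<forall>a. \<phi> a \<in> linear_polys CARD('k)) \<and>
     \<phi> 1 = [:0, 1:] \<and>
     (\<forall>a b. \<phi> (a + b) = \<phi> a + \<phi> b) \<and>
     (\<forall>a b. \<phi> (a * b) = pcompose (\<phi> a) (\<phi> b)) \<and>
     (\<forall>c a. \<phi> (smult c a) = smult (\<iota> c) (\<phi> a)) \<and>
     (\<exists>g. g r \<noteq> 0 \<and>
        \<phi> [:0, 1:] = [:0, \<gamma> [:0, 1:]:] + (\<Sum>i=1..r. monom (g i) (CARD('k) ^ i)))"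

text \<open>The coefficient \<open>g\<^sub>i\<close> of \<open>\<tau>\<^sup>i\<close> in \<open>\<phi>\<^sub>T\<close>.\<close>

definition drinfeld_coeff ::
  "('k::{field,finite} poly \<Rightarrow> 'l::{field,finite} poly) \<Rightarrow> nat \<Rightarrow> 'l" where
  "drinfeld_coeff \<phi> i = coeff (\<phi> [:0, 1:]) (CARD('k) ^ i)"

text \<open>\<open>\<psi>\<^sub>T = x\<^sup>-\<^sup>1 \<phi>\<^sub>T x\<close> for some nonzero \<open>x \<in> L\<close>.\<close>

definition isomorphic_over_L ::
  "('k::{field,finite} poly \<Rightarrow> 'l::{field,finite} poly) \<Rightarrow> ('k poly \<Rightarrow> 'l poly) \<Rightarrow> bool" where
  "isomorphic_over_L \<phi> \<psi> \<longleftrightarrow>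
     (\<exists>x. x \<noteq> 0 \<and>
        \<psi> [:0, 1:] = pcompose [:0, inverse x:] (pcompose (\<phi> [:0, 1:]) [:0, x:]))"

text \<open>
  The admissible \<open>(k\<^sub>1, \<dots>, k\<^sub>l)\<close> and \<open>(\<delta>\<^sub>1, \<dots>, \<delta>\<^sub>l, \<delta>\<^sub>r)\<close>; \<open>k\<close> and \<open>\<delta>\<close> only matter on
  \<open>{1..l}\<close>, and \<open>\<delta>\<^sub>r\<close> is the separate argument \<open>\<delta>r\<close>. The integer division is exact because
  \<open>gcd (k\<^sub>i) r\<close> divides \<open>r\<close>.
\<close>

definition basic_J_index ::
  "nat \<Rightarrow> nat \<Rightarrow> nat \<Rightarrow> (nat \<Rightarrow> nat) \<Rightarrow> (nat \<Rightarrow> int) \<Rightarrow> int \<Rightarrow> bool" where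
  "basic_J_index q r l k \<delta> \<delta>r \<longleftrightarrow>
     l \<ge> 1 \<and>
     strict_mono_on {1..l} k \<and>
     (\<forall>i\<in>{1..l}. 1 \<le> k i \<and> k i < r) \<and>
     (\<Sum>i=1..l. \<delta> i * (int q ^ k i - 1)) = \<delta>r * (int q ^ r - 1) \<and>
     (\<forall>i\<in>{1..l}. 0 \<le> \<delta> i \<and> \<delta> i \<le> (int q ^ r - 1) div (int q ^ gcd (k i) r - 1)) \<and>
     Gcd (insert \<delta>r (\<delta> ` {1..l})) = 1"

definition J_invariant ::
  "nat \<Rightarrow> nat \<Rightarrow> (nat \<Rightarrow> nat) \<Rightarrow> (nat \<Rightarrow> int) \<Rightarrow> int \<Rightarrow>
   ('k::{field,finite} poly \<Rightarrow> 'l::{field,finite} poly) \<Rightarrow> 'l" where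
  "J_invariant r l k \<delta> \<delta>r \<phi> =
     (\<Prod>i=1..l. drinfeld_coeff \<phi> (k i) powi \<delta> i) / (drinfeld_coeff \<phi> r powi \<delta>r)"

definition coeff_support ::
  "nat \<Rightarrow> ('k::{field,finite} poly \<Rightarrow> 'l::{field,finite} poly) \<Rightarrow> nat set" where
  "coeff_support r \<phi> = {i \<in> {1..r}. drinfeld_coeff \<phi> i \<noteq> 0}"

definition FI_exponent ::
  "nat \<Rightarrow> ('k::{field,finite} poly \<Rightarrow> 'l::{field,finite} poly) \<Rightarrow> nat" where
  "FI_exponent r \<phi> = Gcd ((\<lambda>k. CARD('k) ^ k - 1) ` coeff_support r \<phi>)"

definition FI_index ::
  "nat \<Rightarrow> ('k::{field,finite} poly \<Rightarrow> 'l::{field,finite} poly) \<Rightarrow> (nat \<Rightarrow> int) set" where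
  "FI_index r \<phi> =
     {lam \<in> coeff_support r \<phi> \<rightarrow>\<^sub>E UNIV.
        int (FI_exponent r \<phi>) = (\<Sum>k\<in>coeff_support r \<phi>. lam k * (int CARD('k) ^ k - 1))}"

text \<open>The class of a nonzero \<open>y\<close> modulo \<open>d\<close>-th powers, as a coset in the unit group of \<open>L\<close>.\<close>

definition dth_power_class :: "nat \<Rightarrow> 'l::field \<Rightarrow> 'l set" where
  "dth_power_class d y = {y * z ^ d | z. z \<noteq> 0}"

definition FI_component ::
  "nat \<Rightarrow> ('k::{field,finite} poly \<Rightarrow> 'l::{field,finite} poly) \<Rightarrow> (nat \<Rightarrow> int) \<Rightarrow> 'l set" where
  "FI_component r \<phi> lam =
     dth_power_class (FI_exponent r \<phi>)
       (\<Prod>k\<in>coeff_support r \<phi>. drinfeld_coeff \<phi> k powi lam k)"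

text \<open>
  The family indexed by \<^const>\<open>FI_index\<close> is a partial function with that domain, so that
  equality of two families includes equality of their index sets.
\<close>

definition fine_isomorphy_invariant ::
  "nat \<Rightarrow> ('k::{field,finite} poly \<Rightarrow> 'l::{field,finite} poly) \<Rightarrow> ((nat \<Rightarrow> int) \<rightharpoonup> 'l set)" where
  "fine_isomorphy_invariant r \<phi> =
     (\<lambda>lam. if lam \<in> FI_index r \<phi> then Some (FI_component r \<phi> lam) else None)"

end

theory Submission
  imports Defs
begin

text \<open>
  Let \<open>c\<^sub>k\<close> be the quotient of the \<open>k\<close>-th coefficients of \<open>\<psi>\<^sub>T\<close> and \<open>\<phi>\<^sub>T\<close> on the common support
  \<open>S\<close>; an isomorphism is an \<open>x\<close> with \<open>c\<^sub>k = x\<^bsup>q^k-1\<^esup>\<close> for all \<open>k \<in> S\<close>. Equality of the basic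
  \<open>J\<close>-invariants says that \<open>\<Prod> c\<^sub>k\<^bsup>m\<^sub>k\<^esup> = 1\<close> for the basic exponent vectors \<open>m\<close>, and these
  generate the lattice of all \<open>m\<close> with \<open>\<Sum> m\<^sub>k (q\<^sup>k - 1) = 0\<close>: the vectors supported on \<open>{k, r}\<close>
  with the maximal admissible entry at \<open>k\<close> reduce every entry of \<open>m\<close> into the admissible range,
  and dividing by the gcd makes the rest basic. The fine invariant gives \<open>z\<close> with
  \<open>\<Prod> c\<^sub>k\<^bsup>\<lambda>\<^sub>k\<^esup> = z\<^sup>d\<close>, where \<open>\<Sum> \<lambda>\<^sub>k (q\<^sup>k - 1) = d\<close>. The vector \<open>((q\<^sup>k - 1) / d) \<lambda> - 1\<^sub>k\<close>, with
  \<open>1\<^sub>k\<close> the \<open>k\<close>-th unit vector, lies in the lattice, so that \<open>c\<^sub>k = z\<^bsup>q^k-1\<^esup>\<close>.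
\<close>

section \<open>Products of integer powers, and Bezout coefficients of a finite family\<close>

lemma prod_powi_add:
  fixes c :: "'i \<Rightarrow> 'a::field"
  assumes "\<And>i. i \<in> A \<Longrightarrow> c i \<noteq> 0"
  shows "(\<Prod>i\<in>A. c i powi (m i + n i)) = (\<Prod>i\<in>A. c i powi m i) * (\<Prod>i\<in>A. c i powi n i)"
  using assms by (simp add: power_int_add flip: prod.distrib)

lemma prod_powi_mult:
  fixes c :: "'i \<Rightarrow> 'a::field"
  shows "(\<Prod>i\<in>A. c i powi (m i * e)) = (\<Prod>i\<in>A. c i powi m i) powi e"
  by (induction A rule: infinite_finite_induct)
    (simp_all add: power_int_mult power_int_mult_distrib)

lemma powi_sum:
  fixes x :: "'a::field"
  assumes "x \<noteq> 0"
  shows "x powi (\<Sum>i\<in>A. m i) = (\<Prod>i\<in>A. x powi m i)"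
  using assms by (induction A rule: infinite_finite_induct) (simp_all add: power_int_add)

lemma bezout_Gcd_image:
  fixes f :: "'i \<Rightarrow> int"
  assumes "finite A"
  shows "\<exists>m. (\<Sum>i\<in>A. m i * f i) = Gcd (f ` A)"
  using assms
proof (induction A rule: finite_induct)
  case (insert a A)
  obtain m where m: "(\<Sum>i\<in>A. m i * f i) = Gcd (f ` A)"
    using insert.IH by blast
  obtain u v where uv: "u * f a + v * Gcd (f ` A) = gcd (f a) (Gcd (f ` A))"
    using bezout_int by blast
  have "(\<Sum>i\<in>insert a A. (if i = a then u else v * m i) * f i)
      = u * f a + (\<Sum>i\<in>A. v * m i * f i)"
    using insert.hyps by (auto intro!: sum.cong)
  also have "\<dots> = Gcd (f ` insert a A)"
    using uv by (simp add: mult.assoc flip: m sum_distrib_left)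
  finally show ?case
    by (rule exI[where x = "\<lambda>i. if i = a then u else v * m i"])
qed simp

section \<open>Exponent bounds and primitive exponent vectors\<close>

lemma power_minus_one_dvd:
  fixes q :: int
  assumes "a dvd b"
  shows "q ^ a - 1 dvd q ^ b - 1"
proof -
  obtain c where "b = a * c"
    using assms by (rule dvdE)
  then show ?thesis
    using power_diff_1_eq[of "q ^ a" c] by (simp add: power_mult)
qed

text \<open>Both sides are the product of \<open>q ^ k - 1\<close> and \<open>q ^ r - 1\<close>
  divided by \<open>q ^ gcd k r - 1\<close>, which divides either factor. Hence the largest exponent
  admissible at \<open>k\<close> gives a relation supported on \<open>k\<close> and
  \<open>r\<close>.\<close>

lemma basic_J_index_bound_identity:
  fixes q :: int
  shows "((q ^ r - 1) div (q ^ gcd k r - 1)) * (q ^ k - 1)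
       = ((q ^ k - 1) div (q ^ gcd k r - 1)) * (q ^ r - 1)"
  using power_minus_one_dvd[of "gcd k r" k q] power_minus_one_dvd[of "gcd k r" r q]
  by (metis div_mult_swap gcd_dvd1 gcd_dvd2 mult.commute)

lemma basic_J_index_bound_pos:
  assumes "2 \<le> q" "1 \<le> k" "1 \<le> r"
  shows "0 < (int q ^ r - 1) div (int q ^ gcd k r - 1)"
proof -
  have *: "1 < int q ^ n" if "1 \<le> n" for n
    using assms(1) that by (intro one_less_power) auto
  have "0 < int q ^ gcd k r - 1" "0 < int q ^ r - 1"
    using *[of "gcd k r"] *[of r] assms by (auto simp: Suc_le_eq)
  then show ?thesis
    using zdvd_imp_le[OF power_minus_one_dvd[OF gcd_dvd2]] by (simp only: pos_imp_zdiv_pos_iff)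
qed

text \<open>
  All basic invariants needed below have \<open>(k\<^sub>1, \<dots>, k\<^sub>l) = (1, \<dots>, r - 1)\<close>: the indices that
  are to be left out get the exponent \<open>0\<close>.
\<close>

lemma basic_J_index_primitive:
  assumes q: "2 \<le> q"
    and bound: "\<And>i. i \<in> {1..r - 1} \<Longrightarrow>
          0 \<le> m i \<and> m i \<le> (int q ^ r - 1) div (int q ^ gcd i r - 1)"
    and rel: "(\<Sum>i=1..r - 1. m i * (int q ^ i - 1)) = mr * (int q ^ r - 1)"
    and nz: "\<exists>i\<in>{1..r - 1}. m i \<noteq> 0"
  obtains G \<delta> \<delta>r where "0 < G" "\<And>i. m i = 0 \<Longrightarrow> \<delta> i = 0"
    "\<And>i. i \<in> {1..r - 1} \<Longrightarrow> m i = \<delta> i * G" "mr = \<delta>r * G"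
    "basic_J_index q r (r - 1) (\<lambda>i. i) \<delta> \<delta>r"
proof -
  define G where "G = Gcd (insert mr (m ` {1..r - 1}))"
  define \<delta> where "\<delta> = (\<lambda>i. m i div G)"
  define \<delta>r where "\<delta>r = mr div G"
  have "G \<noteq> 0"
    using nz by (auto simp: G_def)
  then have G: "0 < G"
    by (simp add: G_def order.not_eq_order_implies_strict)
  have m: "m i = \<delta> i * G" if "i \<in> {1..r - 1}" for i
    using that unfolding \<delta>_def by (metis G_def Gcd_dvd_int dvd_div_mult_self image_eqI insertI2)
  have mr: "mr = \<delta>r * G"
    unfolding \<delta>r_def by (metis G_def Gcd_dvd_int dvd_div_mult_self insertI1)
  have "(\<Sum>i=1..r - 1. \<delta> i * (int q ^ i - 1)) * G = (\<Sum>i=1..r - 1. m i * (int q ^ i - 1))"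
    by (auto simp: sum_distrib_right m intro!: sum.cong)
  also have "\<dots> = \<delta>r * (int q ^ r - 1) * G"
    using rel mr by simp
  finally have rel': "(\<Sum>i=1..r - 1. \<delta> i * (int q ^ i - 1)) = \<delta>r * (int q ^ r - 1)"
    using G by simp
  \<comment> \<open>The entries have gcd \<open>G\<close> by definition, so pulling out the factor
    \<open>G\<close> leaves gcd 1 for the quotients.\<close>
  have "insert mr (m ` {1..r - 1}) = (*) G ` insert \<delta>r (\<delta> ` {1..r - 1})"
    using m mr by (auto simp: image_iff mult.commute)
  then have "G = G * Gcd (insert \<delta>r (\<delta> ` {1..r - 1}))"
    using G unfolding G_def[symmetric] by (metis G_def Gcd_int_greater_eq_0 Gcd_mult abs_of_nonneg
        abs_mult normalize_int_def order_less_imp_le)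
  then have gcd1: "Gcd (insert \<delta>r (\<delta> ` {1..r - 1})) = 1"
    using G by simp
  have bound': "0 \<le> \<delta> i \<and> \<delta> i \<le> (int q ^ r - 1) div (int q ^ gcd i r - 1)"
    if "i \<in> {1..r - 1}" for i
  proof
    show "0 \<le> \<delta> i"
      using bound[OF that] G by (simp add: \<delta>_def pos_imp_zdiv_nonneg_iff)
    then have "\<delta> i \<le> m i"
      using G mult_left_mono[of 1 G "\<delta> i"] by (simp add: m[OF that])
    then show "\<delta> i \<le> (int q ^ r - 1) div (int q ^ gcd i r - 1)"
      using bound[OF that] by simp
  qed
  have "basic_J_index q r (r - 1) (\<lambda>i. i) \<delta> \<delta>r"
    unfolding basic_J_index_def using nz rel' bound' gcd1
    by (auto simp: strict_mono_on_def)
  then show thesis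
    by (intro that[OF G _ m mr]) (simp_all add: \<delta>_def)
qed

section \<open>Multiplicative relations from basic invariants\<close>

text \<open>Each \<open>m i\<close> is divided with remainder by the bound \<open>N i\<close>, and
  no step introduces an entry outside \<open>S\<close>. This matters because basic relations are
  available only for exponents vanishing outside \<open>S\<close>, later the common support.\<close>

lemma powi_relation_of_basic:
  fixes c :: "nat \<Rightarrow> 'a::field"
  assumes q: "2 \<le> q" and r: "1 \<le> r" and c: "\<And>i. c i \<noteq> 0"
    and basic: "\<And>\<delta> \<delta>r. \<lbrakk>basic_J_index q r (r - 1) (\<lambda>i. i) \<delta> \<delta>r; \<And>i. i \<notin> S \<Longrightarrow> \<delta> i = 0\<rbrakk>
          \<Longrightarrow> (\<Prod>i=1..r - 1. c i powi \<delta> i) = c r powi \<delta>r"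
    and supp: "\<And>i. i \<notin> S \<Longrightarrow> m i = 0"
    and rel: "(\<Sum>i=1..r - 1. m i * (int q ^ i - 1)) = mr * (int q ^ r - 1)"
  shows "(\<Prod>i=1..r - 1. c i powi m i) = c r powi mr"
proof -
  define N where "N = (\<lambda>i. (int q ^ r - 1) div (int q ^ gcd i r - 1))"
  define D where "D = (\<lambda>i. (int q ^ i - 1) div (int q ^ gcd i r - 1))"
  have qr: "int q ^ r - 1 \<noteq> 0"
    using q r one_less_power[of "int q" r] by linarith
  have ND: "N i * (int q ^ i - 1) = D i * (int q ^ r - 1)" for i
    unfolding N_def D_def by (rule basic_J_index_bound_identity)
  have N_pos: "0 < N i" if "i \<in> {1..r - 1}" for i
    unfolding N_def using that q r by (intro basic_J_index_bound_pos) auto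
  \<comment> \<open>Within the bounds a nonzero vector is \<open>G\<close> times a basic one, so its
    relation is the \<open>G\<close>-th power of a basic relation; the zero vector forces
    \<open>nr = 0\<close>.\<close>
  have bounded: "(\<Prod>i=1..r - 1. c i powi n i) = c r powi nr"
    if supp: "\<And>i. i \<notin> S \<Longrightarrow> n i = 0"
      and bd: "\<And>i. i \<in> {1..r - 1} \<Longrightarrow> 0 \<le> n i \<and> n i \<le> N i"
      and rel: "(\<Sum>i=1..r - 1. n i * (int q ^ i - 1)) = nr * (int q ^ r - 1)" for n nr
  proof (cases "\<exists>i\<in>{1..r - 1}. n i \<noteq> 0")
    case True
    then obtain G \<delta> \<delta>r where *: "\<And>i. n i = 0 \<Longrightarrow> \<delta> i = 0"
        "\<And>i. i \<in> {1..r - 1} \<Longrightarrow> n i = \<delta> i * G" "nr = \<delta>r * G"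
        "basic_J_index q r (r - 1) (\<lambda>i. i) \<delta> \<delta>r"
      using basic_J_index_primitive[OF q bd[unfolded N_def] rel] by metis
    have "(\<Prod>i=1..r - 1. c i powi n i) = (\<Prod>i=1..r - 1. c i powi \<delta> i) powi G"
      unfolding prod_powi_mult[symmetric] using *(2) by (intro prod.cong) auto
    also have "\<dots> = c r powi nr"
      using basic[OF *(4)] *(1,3) supp by (simp add: power_int_mult)
    finally show ?thesis .
  next
    case False
    then have "nr = 0"
      using rel qr by simp
    then show ?thesis
      using False by simp
  qed
  \<comment> \<open>The vector with the maximal entry \<open>N k\<close> at \<open>k\<close> trades
    \<open>c k powi N k\<close> for a power of \<open>c r\<close>.\<close>
  have single: "c k powi N k = c r powi D k" if k: "k \<in> {1..r - 1}" "k \<in> S" for k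
  proof -
    let ?n = "\<lambda>i. if i = k then N k else 0"
    have "(\<Sum>i=1..r - 1. ?n i * (int q ^ i - 1)) = (\<Sum>i=1..r - 1. if i = k then N k * (int q ^ k - 1) else 0)"
      by (intro sum.cong) auto
    also have "\<dots> = D k * (int q ^ r - 1)"
      using k ND by simp
    finally have "(\<Prod>i=1..r - 1. c i powi ?n i) = c r powi D k"
      using k N_pos by (intro bounded) (auto simp: less_imp_le)
    moreover have "(\<Prod>i=1..r - 1. c i powi ?n i) = (\<Prod>i=1..r - 1. if i = k then c k powi N k else 1)"
      by (intro prod.cong) auto
    ultimately show ?thesis
      using k by simp
  qed
  define t where "t = (\<lambda>i. m i div N i)"
  have m: "m i = N i * t i + m i mod N i" for i
    by (simp add: t_def)
  have tS: "t i = 0" if "i \<notin> S" for i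
    using supp[OF that] by (simp add: t_def)
  have quot: "(\<Prod>i=1..r - 1. c i powi (N i * t i)) = c r powi (\<Sum>i=1..r - 1. D i * t i)"
    unfolding powi_sum[OF c]
  proof (intro prod.cong refl)
    fix i assume "i \<in> {1..r - 1}"
    then show "c i powi (N i * t i) = c r powi (D i * t i)"
      using single[of i] tS[of i] by (cases "i \<in> S") (simp_all add: power_int_mult)
  qed
  \<comment> \<open>Replacing \<open>m i\<close> by its remainder lowers the exponent of
    \<open>c r\<close> by \<open>D i * t i\<close>, so the remainders form a relation within the
    bounds.\<close>
  have "(\<Sum>i=1..r - 1. (m i mod N i) * (int q ^ i - 1))
      = (\<Sum>i=1..r - 1. m i * (int q ^ i - 1) - D i * t i * (int q ^ r - 1))"
  proof (intro sum.cong refl)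
    fix i
    have "m i * (int q ^ i - 1) = t i * (N i * (int q ^ i - 1)) + (m i mod N i) * (int q ^ i - 1)"
      by (subst m) (simp add: algebra_simps)
    then show "(m i mod N i) * (int q ^ i - 1) = m i * (int q ^ i - 1) - D i * t i * (int q ^ r - 1)"
      unfolding ND by (simp only: mult.assoc mult.left_commute[of "D i"] add_diff_cancel_left')
  qed
  also have "\<dots> = (mr - (\<Sum>i=1..r - 1. D i * t i)) * (int q ^ r - 1)"
    by (simp only: sum_subtractf rel left_diff_distrib[of mr] sum_distrib_right)
  finally have rem: "(\<Prod>i=1..r - 1. c i powi (m i mod N i)) = c r powi (mr - (\<Sum>i=1..r - 1. D i * t i))"
    using supp N_pos by (intro bounded) (auto simp: less_imp_le)
  have "(\<Prod>i=1..r - 1. c i powi m i) = (\<Prod>i=1..r - 1. c i powi (N i * t i + m i mod N i))"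
    by (simp only: m[symmetric])
  also have "\<dots> = c r powi (\<Sum>i=1..r - 1. D i * t i) * c r powi (mr - (\<Sum>i=1..r - 1. D i * t i))"
    by (simp only: prod_powi_add[OF c] quot rem)
  also have "\<dots> = c r powi mr"
    using c by (simp flip: power_int_add)
  finally show ?thesis .
qed

text \<open>A basic vector concentrated at \<open>k\<close> gives an invariant that vanishes exactly
  when the coefficient at \<open>k\<close> does, because its exponent there is nonzero. This makes
  the supports of two modules agree.\<close>

lemma vanishing_of_basic_J:
  fixes u v :: "nat \<Rightarrow> 'a::field"
  assumes q: "2 \<le> q" and r: "u r \<noteq> 0" "v r \<noteq> 0"
    and J: "\<And>\<delta> \<delta>r. basic_J_index q r (r - 1) (\<lambda>i. i) \<delta> \<delta>r \<Longrightarrow>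
          (\<Prod>i=1..r - 1. u i powi \<delta> i) / u r powi \<delta>r = (\<Prod>i=1..r - 1. v i powi \<delta> i) / v r powi \<delta>r"
    and k: "k \<in> {1..r}"
  shows "u k = 0 \<longleftrightarrow> v k = 0"
proof (cases "k = r")
  case True
  then show ?thesis using r by simp
next
  case False
  with k have k: "k \<in> {1..r - 1}" by auto
  define N where "N = (int q ^ r - 1) div (int q ^ gcd k r - 1)"
  let ?n = "\<lambda>i. if i = k then N else 0"
  have N: "0 < N"
    unfolding N_def using k q by (intro basic_J_index_bound_pos) auto
  have "(\<Sum>i=1..r - 1. ?n i * (int q ^ i - 1)) = (\<Sum>i=1..r - 1. if i = k then N * (int q ^ k - 1) else 0)"
    by (intro sum.cong) auto
  also have "\<dots> = ((int q ^ k - 1) div (int q ^ gcd k r - 1)) * (int q ^ r - 1)"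
    using k by (simp add: N_def basic_J_index_bound_identity)
  finally have rel: "(\<Sum>i=1..r - 1. ?n i * (int q ^ i - 1))
      = ((int q ^ k - 1) div (int q ^ gcd k r - 1)) * (int q ^ r - 1)" .
  have bound: "0 \<le> ?n i \<and> ?n i \<le> (int q ^ r - 1) div (int q ^ gcd i r - 1)"
    if "i \<in> {1..r - 1}" for i
    using that N basic_J_index_bound_pos[OF q, of i r] by (auto simp: N_def less_imp_le)
  have "\<exists>i\<in>{1..r - 1}. ?n i \<noteq> 0"
    using k N by auto
  from basic_J_index_primitive[OF q bound rel this]
  obtain G \<delta> \<delta>r where *: "\<And>i. ?n i = 0 \<Longrightarrow> \<delta> i = 0"
      "\<And>i. i \<in> {1..r - 1} \<Longrightarrow> ?n i = \<delta> i * G"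
      "basic_J_index q r (r - 1) (\<lambda>i. i) \<delta> \<delta>r"
    by metis
  have \<delta>k: "\<delta> k \<noteq> 0"
    using *(2)[OF k] N by auto
  have "(\<Prod>i=1..r - 1. w i powi \<delta> i) = w k powi \<delta> k" for w :: "nat \<Rightarrow> 'a"
  proof -
    have "(\<Prod>i=1..r - 1. w i powi \<delta> i) = (\<Prod>i=1..r - 1. if i = k then w k powi \<delta> k else 1)"
      using *(1) by (intro prod.cong) auto
    then show ?thesis using k by simp
  qed
  then have "u k powi \<delta> k / u r powi \<delta>r = v k powi \<delta> k / v r powi \<delta>r"
    using J[OF *(3)] by simp
  then show ?thesis
    using r \<delta>k by (metis divide_eq_0_iff power_int_eq_0_iff)
qed

text \<open>Equalities of invariants become relations between the quotients
  \<open>v i / u i\<close>; the entry of \<open>m\<close> at \<open>r\<close> moves to the other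
  side with its sign changed.\<close>

lemma powi_relation_of_basic_J:
  fixes u v :: "nat \<Rightarrow> 'a::field"
  assumes q: "2 \<le> q" and r: "1 \<le> r" "u r \<noteq> 0" "v r \<noteq> 0"
    and J: "\<And>\<delta> \<delta>r. basic_J_index q r (r - 1) (\<lambda>i. i) \<delta> \<delta>r \<Longrightarrow>
          (\<Prod>i=1..r - 1. u i powi \<delta> i) / u r powi \<delta>r = (\<Prod>i=1..r - 1. v i powi \<delta> i) / v r powi \<delta>r"
    and S: "S = {i \<in> {1..r}. u i \<noteq> 0}" "S = {i \<in> {1..r}. v i \<noteq> 0}"
    and rel: "(\<Sum>i\<in>S. m i * (int q ^ i - 1)) = 0"
  shows "(\<Prod>i\<in>S. (v i / u i) powi m i) = 1"
proof -
  \<comment> \<open>The values 1 and 0 outside \<open>S\<close> keep \<open>c\<close> nonzero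
    everywhere and leave products and sums over \<open>S\<close> unchanged.\<close>
  define c where "c = (\<lambda>i. if i \<in> S then v i / u i else 1)"
  define m' where "m' = (\<lambda>i. if i \<in> S then m i else 0)"
  have uv: "u i \<noteq> 0" "v i \<noteq> 0" if "i \<in> S" for i
    using that S by auto
  have c: "c i \<noteq> 0" for i
    using uv by (simp add: c_def)
  have S_sub: "S \<subseteq> {1..r}" and rS: "r \<in> S"
    using S(1) r by auto
  have split: "{1..r} = insert r {1..r - 1}" "r \<notin> {1..r - 1}"
    using r(1) by auto
  have basic: "(\<Prod>i=1..r - 1. c i powi \<delta> i) = c r powi \<delta>r"
    if "basic_J_index q r (r - 1) (\<lambda>i. i) \<delta> \<delta>r" and \<delta>: "\<And>i. i \<notin> S \<Longrightarrow> \<delta> i = 0" for \<delta> \<delta>r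
  proof -
    \<comment> \<open>Outside \<open>S\<close> the factor is \<open>0 powi 0 = 1\<close>, so
      division by this product is possible even if some coefficients vanish.\<close>
    have nz: "(\<Prod>i=1..r - 1. u i powi \<delta> i) \<noteq> 0"
      using uv \<delta> by (auto simp: power_int_eq_0_iff)
    have "(\<Prod>i=1..r - 1. c i powi \<delta> i) = (\<Prod>i=1..r - 1. v i powi \<delta> i / u i powi \<delta> i)"
      using \<delta> by (intro prod.cong) (auto simp: c_def power_int_divide_distrib)
    also have "\<dots> = (v r powi \<delta>r) / (u r powi \<delta>r)"
      using J[OF that(1)] nz r by (simp add: prod_dividef field_simps)
    also have "\<dots> = c r powi \<delta>r"
      using rS by (simp add: c_def power_int_divide_distrib)
    finally show ?thesis .
  qed
  have "(\<Sum>i=1..r. m' i * (int q ^ i - 1)) = (\<Sum>i\<in>S. m i * (int q ^ i - 1))"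
    using S_sub by (intro sum.mono_neutral_cong_right) (auto simp: m'_def)
  then have "(\<Sum>i=1..r - 1. m' i * (int q ^ i - 1)) = (- m' r) * (int q ^ r - 1)"
    using rel split by simp
  then have "(\<Prod>i=1..r - 1. c i powi m' i) = c r powi (- m' r)"
    by (intro powi_relation_of_basic[where S = S, OF q r(1) c basic]) (auto simp: m'_def)
  then have "(\<Prod>i=1..r. c i powi m' i) = 1"
    using c split by (simp add: power_int_minus)
  moreover have "(\<Prod>i=1..r. c i powi m' i) = (\<Prod>i\<in>S. (v i / u i) powi m i)"
    using S_sub by (intro prod.mono_neutral_cong_right) (auto simp: m'_def c_def)
  ultimately show ?thesis by simp
qed

text \<open>Extraction of the scaling factor for general integer weights \<open>f\<close>; below,
  \<open>f k\<close> is \<open>int CARD('k) ^ k - 1\<close>.\<close>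

lemma scaling_of_relations:
  fixes c :: "nat \<Rightarrow> 'a::field"
  assumes S: "finite S" and c: "\<And>i. i \<in> S \<Longrightarrow> c i \<noteq> 0"
    and rel: "\<And>m. (\<Sum>i\<in>S. m i * f i) = 0 \<Longrightarrow> (\<Prod>i\<in>S. c i powi m i) = 1"
    and lam: "(\<Sum>i\<in>S. lam i * f i) = d"
    and z: "(\<Prod>i\<in>S. c i powi lam i) = z powi d"
    and k: "k \<in> S" "d dvd f k"
  shows "c k = z powi f k"
proof -
  obtain e where e: "f k = d * e"
    using k(2) by (rule dvdE)
  \<comment> \<open>Minus the \<open>k\<close>-th unit vector: added to \<open>e\<close> times
    \<open>lam\<close> it gives weight \<open>d * e - f k = 0\<close>.\<close>
  let ?unit = "\<lambda>i. if i = k then -1 else 0 :: int"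
  have "(\<Sum>i\<in>S. ?unit i * f i) = (\<Sum>i\<in>S. if i = k then - f k else 0)"
    by (intro sum.cong) auto
  also have "\<dots> = - (d * e)"
    using S k by (simp add: e)
  finally have unit: "(\<Sum>i\<in>S. ?unit i * f i) = - (d * e)" .
  have "(\<Sum>i\<in>S. lam i * e * f i) = d * e"
    by (simp add: sum_distrib_left mult_ac flip: lam)
  with unit have "(\<Sum>i\<in>S. (lam i * e + ?unit i) * f i) = 0"
    by (simp only: distrib_right sum.distrib add.right_inverse)
  then have "1 = (\<Prod>i\<in>S. c i powi (lam i * e + ?unit i))"
    by (rule rel[symmetric])
  also have "\<dots> = z powi f k * (\<Prod>i\<in>S. c i powi ?unit i)"
    by (simp only: prod_powi_add[OF c] prod_powi_mult z e power_int_mult[of z])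
  also have "(\<Prod>i\<in>S. c i powi ?unit i) = (\<Prod>i\<in>S. if i = k then inverse (c k) else 1)"
    by (intro prod.cong) (auto simp: power_int_minus)
  also have "\<dots> = inverse (c k)"
    using S k by simp
  finally show ?thesis
    using c[OF k(1)] by (simp add: field_simps)
qed

section \<open>Coefficients of Drinfeld modules and isomorphisms\<close>

lemma card_field_ge_2: "2 \<le> CARD('k::{field,finite})"
proof -
  have "card {0, 1 :: 'k} \<le> CARD('k)"
    by (intro card_mono) auto
  then show ?thesis by simp
qed

text \<open>The exponents \<open>CARD('k) ^ i\<close> are distinct, so the coefficients
  \<open>g i\<close> can be read off. The sum of case distinctions covers every degree
  \<open>n\<close> at once and lets scaling be compared termwise.\<close>

lemma coeff_drinfeld_module:
  fixes \<phi> :: "'k::{field,finite} poly \<Rightarrow> 'l::{field,finite} poly"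
  assumes "drinfeld_module \<iota> \<gamma> r \<phi>"
  shows "coeff (\<phi> [:0, 1:]) n
      = (if n = 1 then \<gamma> [:0, 1:] else 0) + (\<Sum>i=1..r. if CARD('k) ^ i = n then drinfeld_coeff \<phi> i else 0)"
    and "drinfeld_coeff \<phi> r \<noteq> 0" and "1 \<le> r"
proof -
  obtain g where g: "g r \<noteq> 0" "1 \<le> r"
      "\<phi> [:0, 1:] = [:0, \<gamma> [:0, 1:]:] + (\<Sum>i=1..r. monom (g i) (CARD('k) ^ i))"
    using assms unfolding drinfeld_module_def by blast
  have q: "1 < CARD('k)"
    using card_field_ge_2[where 'k = 'k] by simp
  have co: "coeff (\<phi> [:0, 1:]) n
      = (if n = 1 then \<gamma> [:0, 1:] else 0) + (\<Sum>i=1..r. if CARD('k) ^ i = n then g i else 0)" for n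
    by (simp add: g(3) coeff_sum coeff_pCons split: nat.split)
  have dc: "drinfeld_coeff \<phi> i = g i" if "i \<in> {1..r}" for i
    using that q by (simp add: drinfeld_coeff_def co power_inject_exp)
  show "coeff (\<phi> [:0, 1:]) n
      = (if n = 1 then \<gamma> [:0, 1:] else 0) + (\<Sum>i=1..r. if CARD('k) ^ i = n then drinfeld_coeff \<phi> i else 0)"
    unfolding co using dc by (intro arg_cong2[where f = "(+)"] sum.cong) auto
  show "drinfeld_coeff \<phi> r \<noteq> 0" "1 \<le> r"
    using g dc[of r] by auto
qed

text \<open>Conjugation by \<open>x\<close> multiplies the coefficient at degree \<open>n\<close> by
  \<open>x powi (int n - 1)\<close>. The linear terms of both modules are equal and stay unchanged,
  which leaves the degrees \<open>CARD('k) ^ i\<close>.\<close>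

lemma isomorphic_over_L_iff:
  fixes \<phi> \<psi> :: "'k::{field,finite} poly \<Rightarrow> 'l::{field,finite} poly"
  assumes \<phi>: "drinfeld_module \<iota> \<gamma> r \<phi>" and \<psi>: "drinfeld_module \<iota> \<gamma> r \<psi>"
  shows "isomorphic_over_L \<phi> \<psi> \<longleftrightarrow> (\<exists>x. x \<noteq> 0 \<and>
    (\<forall>i\<in>{1..r}. drinfeld_coeff \<psi> i = drinfeld_coeff \<phi> i * x powi (int CARD('k) ^ i - 1)))"
proof -
  let ?q = "CARD('k)"
  have "\<psi> [:0, 1:] = pcompose [:0, inverse x:] (pcompose (\<phi> [:0, 1:]) [:0, x:]) \<longleftrightarrow>
      (\<forall>i\<in>{1..r}. drinfeld_coeff \<psi> i = drinfeld_coeff \<phi> i * x powi (int ?q ^ i - 1))"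
    (is "?L \<longleftrightarrow> ?R") if x: "x \<noteq> 0" for x
  proof -
    \<comment> \<open>The exponent is an integer because degree 0 gives
      \<open>inverse x\<close>.\<close>
    have scale: "inverse x * x ^ n = x powi (int n - 1)" for n
      using x by (simp add: power_int_diff field_simps)
    have "?L \<longleftrightarrow> (\<forall>n. coeff (\<psi> [:0, 1:]) n = coeff (\<phi> [:0, 1:]) n * x powi (int n - 1))"
      by (simp add: poly_eq_iff pcompose_pCons coeff_pcompose_linear mult_ac flip: scale)
    also have "\<dots> \<longleftrightarrow> ?R"
    proof
      assume *: "\<forall>n. coeff (\<psi> [:0, 1:]) n = coeff (\<phi> [:0, 1:]) n * x powi (int n - 1)"
      show ?R
        using *[rule_format, of "?q ^ _"] by (simp add: drinfeld_coeff_def)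
    next
      assume R: ?R
      show "\<forall>n. coeff (\<psi> [:0, 1:]) n = coeff (\<phi> [:0, 1:]) n * x powi (int n - 1)"
        unfolding coeff_drinfeld_module(1)[OF \<phi>] coeff_drinfeld_module(1)[OF \<psi>]
          distrib_right sum_distrib_right
        using R by (intro allI arg_cong2[where f = "(+)"] sum.cong) auto
    qed
    finally show ?thesis .
  qed
  then show ?thesis
    unfolding isomorphic_over_L_def by blast
qed

section \<open>Invariance under isomorphism\<close>

text \<open>Both kinds of invariant are built from monomials in the coefficients; an isomorphism
  multiplies such a monomial by \<open>x\<close> to the power of its weight.\<close>

lemma prod_powi_scaled:
  fixes u :: "'i \<Rightarrow> 'a::field"
  assumes "x \<noteq> 0"
  shows "(\<Prod>i\<in>A. (u i * x powi f i) powi m i) = (\<Prod>i\<in>A. u i powi m i) * x powi (\<Sum>i\<in>A. m i * f i)"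
  unfolding powi_sum[OF assms]
  by (simp add: power_int_mult_distrib power_int_mult mult.commute[of "m _"] flip: prod.distrib)

text \<open>The linear equation between the exponents gives numerator and denominator the same
  weight, so the powers of \<open>x\<close> cancel.\<close>

lemma J_invariant_isomorphic:
  fixes \<phi> \<psi> :: "'k::{field,finite} poly \<Rightarrow> 'l::{field,finite} poly"
  assumes x: "x \<noteq> 0"
    and g: "\<And>i. i \<in> {1..r} \<Longrightarrow> drinfeld_coeff \<psi> i = drinfeld_coeff \<phi> i * x powi (int CARD('k) ^ i - 1)"
    and "1 \<le> r" and J: "basic_J_index CARD('k) r l k \<delta> \<delta>r"
  shows "J_invariant r l k \<delta> \<delta>r \<psi> = J_invariant r l k \<delta> \<delta>r \<phi>"
proof -
  have k: "k i \<in> {1..r}" if "i \<in> {1..l}" for i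
    using J that by (auto simp: basic_J_index_def less_imp_le)
  have "(\<Prod>i=1..l. drinfeld_coeff \<psi> (k i) powi \<delta> i)
      = (\<Prod>i=1..l. (drinfeld_coeff \<phi> (k i) * x powi (int CARD('k) ^ k i - 1)) powi \<delta> i)"
    by (intro prod.cong refl) (simp only: g[OF k])
  also have "\<dots> = (\<Prod>i=1..l. drinfeld_coeff \<phi> (k i) powi \<delta> i) * x powi (\<delta>r * (int CARD('k) ^ r - 1))"
    using J unfolding prod_powi_scaled[OF x] by (simp add: basic_J_index_def)
  finally show ?thesis
    using x \<open>1 \<le> r\<close> by (simp add: J_invariant_def g power_int_mult_distrib power_int_mult mult.commute[of \<delta>r])
qed

lemma dth_power_class_mult: "z \<noteq> 0 \<Longrightarrow> dth_power_class d (y * z ^ d) = dth_power_class d y"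
proof (intro set_eqI iffI)
  fix w assume z: "z \<noteq> 0"
  show "w \<in> dth_power_class d y" if "w \<in> dth_power_class d (y * z ^ d)"
    using that z unfolding dth_power_class_def
    by clarify (metis mult.assoc mult_eq_0_iff power_mult_distrib)
  show "w \<in> dth_power_class d (y * z ^ d)" if w: "w \<in> dth_power_class d y"
  proof -
    obtain v where "w = y * v ^ d" "v \<noteq> 0"
      using w by (auto simp: dth_power_class_def)
    then have "w = y * z ^ d * (v / z) ^ d" "v / z \<noteq> 0"
      using z by (simp_all add: power_divide)
    then show ?thesis
      unfolding dth_power_class_def by blast
  qed
qed

lemma dth_power_class_eqD:
  assumes "dth_power_class d y = dth_power_class d y'"
  obtains z where "z \<noteq> 0" "y = y' * z ^ d"
proof -
  have "y \<in> dth_power_class d y"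
    unfolding dth_power_class_def by (auto intro!: exI[of _ 1])
  then show thesis
    using that unfolding assms by (auto simp: dth_power_class_def)
qed

text \<open>With \<open>d\<close> the \<open>FI_exponent\<close>, the monomial of an index
  \<open>lam\<close> has weight \<open>d\<close> and changes by \<open>x ^ d\<close>, which is
  trivial modulo \<open>d\<close>-th powers. The supports agree since \<open>x\<close> is
  nonzero.\<close>

lemma fine_isomorphy_invariant_isomorphic:
  fixes \<phi> \<psi> :: "'k::{field,finite} poly \<Rightarrow> 'l::{field,finite} poly"
  assumes x: "x \<noteq> 0"
    and g: "\<And>i. i \<in> {1..r} \<Longrightarrow> drinfeld_coeff \<psi> i = drinfeld_coeff \<phi> i * x powi (int CARD('k) ^ i - 1)"
  shows "fine_isomorphy_invariant r \<psi> = fine_isomorphy_invariant r \<phi>"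
proof -
  have S: "coeff_support r \<psi> = coeff_support r \<phi>"
    using x g by (auto simp: coeff_support_def)
  then have E: "FI_exponent r \<psi> = FI_exponent r \<phi>" and B: "FI_index r \<psi> = FI_index r \<phi>"
    by (simp_all add: FI_exponent_def FI_index_def)
  have "FI_component r \<psi> lam = FI_component r \<phi> lam" if "lam \<in> FI_index r \<phi>" for lam
  proof -
    have "(\<Prod>k\<in>coeff_support r \<phi>. drinfeld_coeff \<psi> k powi lam k)
        = (\<Prod>k\<in>coeff_support r \<phi>. (drinfeld_coeff \<phi> k * x powi (int CARD('k) ^ k - 1)) powi lam k)"
      by (intro prod.cong) (auto simp: g coeff_support_def)
    also have "\<dots> = (\<Prod>k\<in>coeff_support r \<phi>. drinfeld_coeff \<phi> k powi lam k) * x ^ FI_exponent r \<phi>"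
      using that unfolding prod_powi_scaled[OF x] by (simp add: FI_index_def flip: power_int_of_nat)
    finally show ?thesis
      using x by (simp add: FI_component_def S E dth_power_class_mult)
  qed
  then show ?thesis
    by (auto simp: fine_isomorphy_invariant_def B)
qed

lemma FI_index_nonempty: "FI_index r \<phi> \<noteq> {}"
  for \<phi> :: "'k::{field,finite} poly \<Rightarrow> 'l::{field,finite} poly"
proof -
  let ?S = "coeff_support r \<phi>"
  have fin: "finite ?S" by (simp add: coeff_support_def)
  obtain m where m: "(\<Sum>k\<in>?S. m k * (int CARD('k) ^ k - 1)) = Gcd ((\<lambda>k. int CARD('k) ^ k - 1) ` ?S)"
    using bezout_Gcd_image[OF fin, of "\<lambda>k. int CARD('k) ^ k - 1"] by (rule exE)
  \<comment> \<open>Subtraction on \<open>nat\<close> is exact here since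
    \<open>CARD('k) ^ k\<close> is at least 1; this identifies the integer gcd from Bezout with
    \<open>FI_exponent\<close>.\<close>
  have "(\<lambda>k. int CARD('k) ^ k - 1) ` ?S = int ` (\<lambda>k. CARD('k) ^ k - 1) ` ?S"
    by (simp add: image_image of_nat_diff)
  then have "restrict m ?S \<in> FI_index r \<phi>"
    using m by (simp add: FI_index_def FI_exponent_def Gcd_int_eq)
  then show ?thesis by blast
qed

section \<open>Classification over the finite field\<close>

theorem theorem2p2:
  fixes \<iota> :: "'k::{field,finite} \<Rightarrow> 'l::{field,finite}"
    and \<gamma> :: "'k poly \<Rightarrow> 'l"
    and \<phi> \<psi> :: "'k poly \<Rightarrow> 'l poly"
    and r :: nat
  assumes "finite_A_field \<iota> \<gamma>"
    and "drinfeld_module \<iota> \<gamma> r \<phi>"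
    and "drinfeld_module \<iota> \<gamma> r \<psi>"
  shows "isomorphic_over_L \<phi> \<psi> \<longleftrightarrow>
    (\<forall>l k \<delta> \<delta>r. basic_J_index CARD('k) r l k \<delta> \<delta>r \<longrightarrow>
        J_invariant r l k \<delta> \<delta>r \<phi> = J_invariant r l k \<delta> \<delta>r \<psi>) \<and>
    fine_isomorphy_invariant r \<phi> = fine_isomorphy_invariant r \<psi>"
    (is "_ \<longleftrightarrow> ?J \<and> ?FI")
proof
  have r: "1 \<le> r" and \<phi>r: "drinfeld_coeff \<phi> r \<noteq> 0" and \<psi>r: "drinfeld_coeff \<psi> r \<noteq> 0"
    using coeff_drinfeld_module assms by blast+
  note iso = isomorphic_over_L_iff[OF assms(2,3)]
  show "?J \<and> ?FI" if "isomorphic_over_L \<phi> \<psi>"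
    using that r J_invariant_isomorphic fine_isomorphy_invariant_isomorphic unfolding iso by metis
  assume "?J \<and> ?FI"
  then have ?J ?FI by auto
  let ?q = "CARD('k)"
  let ?u = "drinfeld_coeff \<phi>" and ?v = "drinfeld_coeff \<psi>"
  define S where "S = coeff_support r \<phi>"
  define d where "d = FI_exponent r \<phi>"
  have q: "2 \<le> ?q" by (rule card_field_ge_2)
  \<comment> \<open>For \<open>r = 1\<close> no index is basic, as \<open>l\<close> must be
    positive, and the claim holds vacuously.\<close>
  have J: "(\<Prod>i=1..r - 1. ?u i powi \<delta> i) / ?u r powi \<delta>r = (\<Prod>i=1..r - 1. ?v i powi \<delta> i) / ?v r powi \<delta>r"
    if "basic_J_index ?q r (r - 1) (\<lambda>i. i) \<delta> \<delta>r" for \<delta> \<delta>r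
    using \<open>?J\<close> that unfolding J_invariant_def by blast
  have zero: "?u k = 0 \<longleftrightarrow> ?v k = 0" if "k \<in> {1..r}" for k
    using vanishing_of_basic_J[where u = ?u and v = ?v, OF q \<phi>r \<psi>r J that] .
  have S_eq: "coeff_support r \<psi> = S"
    using zero by (auto simp: S_def coeff_support_def)
  have S: "S = {i \<in> {1..r}. ?u i \<noteq> 0}" "S = {i \<in> {1..r}. ?v i \<noteq> 0}"
    using S_eq by (simp_all add: S_def coeff_support_def)
  have d_eq: "FI_exponent r \<psi> = d"
    using S_eq by (simp add: d_def FI_exponent_def S_def)
  \<comment> \<open>The class at \<open>lam\<close> provides the \<open>z\<close> that turns out to
    be the isomorphism.\<close>
  obtain lam where lam: "lam \<in> FI_index r \<phi>"
    using FI_index_nonempty by blast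
  then have "FI_component r \<psi> lam = FI_component r \<phi> lam"
    using fun_cong[OF \<open>?FI\<close>, of lam] by (auto simp: fine_isomorphy_invariant_def split: if_splits)
  then obtain z where z: "z \<noteq> 0"
      "(\<Prod>k\<in>S. ?v k powi lam k) = (\<Prod>k\<in>S. ?u k powi lam k) * z ^ d"
    unfolding FI_component_def S_eq d_eq S_def[symmetric] d_def[symmetric]
    by (rule dth_power_class_eqD)
  have "?v k / ?u k = z powi (int ?q ^ k - 1)" if k: "k \<in> S" for k
  proof (rule scaling_of_relations[where f = "\<lambda>k. int ?q ^ k - 1" and c = "\<lambda>k. ?v k / ?u k"])
    show "finite S" by (simp add: S(1))
    show "?v i / ?u i \<noteq> 0" if "i \<in> S" for i
      using that S by auto
    show "(\<Prod>i\<in>S. (?v i / ?u i) powi m i) = 1" if "(\<Sum>i\<in>S. m i * (int ?q ^ i - 1)) = 0" for m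
      by (rule powi_relation_of_basic_J[where u = ?u and v = ?v, OF q r \<phi>r \<psi>r J S that])
    show "(\<Sum>i\<in>S. lam i * (int ?q ^ i - 1)) = int d"
      using lam by (simp add: FI_index_def S_def d_def)
    have "(\<Prod>k\<in>S. ?u k powi lam k) \<noteq> 0"
      using S(1) by (auto simp: power_int_eq_0_iff)
    then show "(\<Prod>i\<in>S. (?v i / ?u i) powi lam i) = z powi int d"
      using z by (simp add: power_int_divide_distrib prod_dividef)
    have "d dvd ?q ^ k - 1"
      using k by (auto simp: d_def FI_exponent_def S_def)
    then have "int d dvd int (?q ^ k - 1)" by (simp only: of_nat_dvd_iff)
    then show "int d dvd int ?q ^ k - 1" by (simp add: of_nat_diff)
  qed (rule k)
  \<comment> \<open>Outside \<open>S\<close> both coefficients vanish, so \<open>z\<close> scales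
    all of them.\<close>
  then have "?v k = ?u k * z powi (int ?q ^ k - 1)" if "k \<in> {1..r}" for k
    using that S(1) zero[OF that] by (cases "k \<in> S") (auto simp: field_simps)
  then show "isomorphic_over_L \<phi> \<psi>"
    unfolding iso using z(1) by blast
qed

end
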